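(* Assume that the kernel $K_\lambda(t)=\partial_\lambda\log w_{\lambda,\theta}(t)$ does not depend on $\theta$. If the kernels $t\mapsto K_\lambda(t)$ and $t\mapsto L_\theta(t)=\partial_\theta\log w_{\lambda,\theta}(t)$ are monotone on $J$, with monotonicity signs $\varepsilon_K$ and $\varepsilon_L$ respectively, then $$\varepsilon_K\,\varepsilon_L\,\partial_\theta\partial_\lambda\log\Phi(\lambda,\theta)\ge 0 .$$
   Context: Setting. $\Lambda,\Theta\subseteq\mathbb R$ are intervals, and $J$ is either an interval of $\mathbb R$, equipped with Lebesgue measure $\mu$, or a subset of $\mathbb N_0=\{0,1,2,\dots\}$, equipped with counting measure $\mu$. For $(\lambda,\theta)\in\Lambda\times\Theta$, $w_{\lambda,\theta}:J\to(0,\infty)$ is a (measurable) positive weight function, and $\Phi(\lambda,\theta)=\int_J w_{\lambda,\theta}(t)\,d\mu(t)$ is assumed finite and positive for all $(\lambda,\theta)$. Standing regularity assumptions. (1) For each parameter $r\in\{\lambda,\theta\}$, with the other parameter fixed, $r\mapsto\log w_{\lambda,\theta}(t)$ is $C^1$ for every $t\in J$, and for every compact interval $B$ in the domain of $r$ there is $m_B\in L^1(J,\mu)$ with $\sup_{r\in B}|\partial_r w_{\lambda,\theta}(t)|\le m_B(t)$ for $\mu$-a.e. $t\in J$. (2) The map $(\lambda,\theta)\mapsto\log w_{\lambda,\theta}(t)$ is $C^2$ on $\Lambda\times\Theta$ for every $t\in J$, and for every compact rectangle $B\subseteq\Lambda\times\Theta$ there is $m_B\in L^1(J,\mu)$ with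 $\sup_{(\lambda,\theta)\in B}|\partial_\lambda\partial_\theta w_{\lambda,\theta}(t)|\le m_B(t)$ for $\mu$-a.e. $t\in J$. Monotonicity sign. For a real function $f$ on $J$: $\varepsilon_f=+1$ if $f$ is nondecreasing, $\varepsilon_f=-1$ if $f$ is nonincreasing, $\varepsilon_f=0$ otherwise. *)

theory Defs
  imports "HOL-Analysis.Analysis"
begin

text \<open>
  Parameter intervals may contain their endpoints, so all derivatives are taken relative to
  the interval (one-sided at an endpoint that belongs to it).  On a nondegenerate interval
  such a derivative is unique whenever it exists.
\<close>

definition nondegenerate_interval :: "real set \<Rightarrow> bool" where
  "nondegenerate_interval S \<longleftrightarrow> is_interval S \<and> (\<exists>a\<in>S. \<exists>b\<in>S. a < b)"

definition partial_fst :: "real set \<Rightarrow> (real \<Rightarrow> real \<Rightarrow> real) \<Rightarrow> real \<Rightarrow> real \<Rightarrow> real" where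
  "partial_fst A f x y = vector_derivative (\<lambda>x'. f x' y) (at x within A)"

definition partial_snd :: "real set \<Rightarrow> (real \<Rightarrow> real \<Rightarrow> real) \<Rightarrow> real \<Rightarrow> real \<Rightarrow> real" where
  "partial_snd B f x y = vector_derivative (\<lambda>y'. f x y') (at y within B)"

definition C1_on :: "real set \<Rightarrow> (real \<Rightarrow> real) \<Rightarrow> bool" where
  "C1_on S f \<longleftrightarrow>
     f differentiable_on S \<and> continuous_on S (\<lambda>x. vector_derivative f (at x within S))"

definition C1_on_rect :: "real set \<Rightarrow> real set \<Rightarrow> (real \<Rightarrow> real \<Rightarrow> real) \<Rightarrow> bool" where
  "C1_on_rect A B f \<longleftrightarrow>
     (\<forall>y\<in>B. (\<lambda>x. f x y) differentiable_on A) \<and>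
     (\<forall>x\<in>A. (\<lambda>y. f x y) differentiable_on B) \<and>
     continuous_on (A \<times> B) (\<lambda>(x, y). partial_fst A f x y) \<and>
     continuous_on (A \<times> B) (\<lambda>(x, y). partial_snd B f x y)"

definition C2_on_rect :: "real set \<Rightarrow> real set \<Rightarrow> (real \<Rightarrow> real \<Rightarrow> real) \<Rightarrow> bool" where
  "C2_on_rect A B f \<longleftrightarrow>
     C1_on_rect A B f \<and> C1_on_rect A B (partial_fst A f) \<and> C1_on_rect A B (partial_snd B f)"

text \<open>The discrete case is embedded in the reals: there \<open>\<nat>\<close> is the set of reals 0, 1, 2, ...\<close>

definition index_measure :: "real set \<Rightarrow> real measure \<Rightarrow> bool" where
  "index_measure J \<mu> \<longleftrightarrow>
     (is_interval J \<and> \<mu> = lebesgue_on J) \<or> (J \<subseteq> \<nat> \<and> \<mu> = count_space J)"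

text \<open>A weight is written \<open>w l \<theta> t\<close> with \<open>l \<in> \<Lambda>\<close>, \<open>\<theta> \<in> \<Theta>\<close>, \<open>t \<in> J\<close>; its values elsewhere play no role.\<close>

definition \<Phi> :: "real measure \<Rightarrow> (real \<Rightarrow> real \<Rightarrow> real \<Rightarrow> real) \<Rightarrow> real \<Rightarrow> real \<Rightarrow> real" where
  "\<Phi> \<mu> w l \<theta> = (\<integral>t. w l \<theta> t \<partial>\<mu>)"

definition weight_family ::
    "real set \<Rightarrow> real set \<Rightarrow> real set \<Rightarrow> real measure \<Rightarrow> (real \<Rightarrow> real \<Rightarrow> real \<Rightarrow> real) \<Rightarrow> bool" where
  "weight_family \<Lambda> \<Theta> J \<mu> w \<longleftrightarrow>
     (\<forall>l\<in>\<Lambda>. \<forall>\<theta>\<in>\<Theta>.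
        (\<forall>t\<in>J. 0 < w l \<theta> t) \<and> w l \<theta> \<in> borel_measurable \<mu> \<and>
        integrable \<mu> (w l \<theta>) \<and> 0 < \<Phi> \<mu> w l \<theta>)"

definition regular_first_order ::
    "real set \<Rightarrow> real set \<Rightarrow> real set \<Rightarrow> real measure \<Rightarrow> (real \<Rightarrow> real \<Rightarrow> real \<Rightarrow> real) \<Rightarrow> bool" where
  "regular_first_order \<Lambda> \<Theta> J \<mu> w \<longleftrightarrow>
     (\<forall>\<theta>\<in>\<Theta>.
        (\<forall>t\<in>J. C1_on \<Lambda> (\<lambda>l. ln (w l \<theta> t))) \<and>
        (\<forall>a b. {a..b} \<subseteq> \<Lambda> \<longrightarrow>
           (\<exists>m. integrable \<mu> m \<and>
              (AE t in \<mu>. \<forall>l\<in>{a..b}. \<bar>partial_fst \<Lambda> (\<lambda>l \<theta>. w l \<theta> t) l \<theta>\<bar> \<le> m t)))) \<and>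
     (\<forall>l\<in>\<Lambda>.
        (\<forall>t\<in>J. C1_on \<Theta> (\<lambda>\<theta>. ln (w l \<theta> t))) \<and>
        (\<forall>c d. {c..d} \<subseteq> \<Theta> \<longrightarrow>
           (\<exists>m. integrable \<mu> m \<and>
              (AE t in \<mu>. \<forall>\<theta>\<in>{c..d}. \<bar>partial_snd \<Theta> (\<lambda>l \<theta>. w l \<theta> t) l \<theta>\<bar> \<le> m t))))"

definition regular_second_order ::
    "real set \<Rightarrow> real set \<Rightarrow> real set \<Rightarrow> real measure \<Rightarrow> (real \<Rightarrow> real \<Rightarrow> real \<Rightarrow> real) \<Rightarrow> bool" where
  "regular_second_order \<Lambda> \<Theta> J \<mu> w \<longleftrightarrow>
     (\<forall>t\<in>J. C2_on_rect \<Lambda> \<Theta> (\<lambda>l \<theta>. ln (w l \<theta> t))) \<and>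
     (\<forall>a b c d. {a..b} \<subseteq> \<Lambda> \<and> {c..d} \<subseteq> \<Theta> \<longrightarrow>
        (\<exists>m. integrable \<mu> m \<and>
           (AE t in \<mu>. \<forall>l\<in>{a..b}. \<forall>\<theta>\<in>{c..d}.
              \<bar>partial_fst \<Lambda> (partial_snd \<Theta> (\<lambda>l \<theta>. w l \<theta> t)) l \<theta>\<bar> \<le> m t)))"

definition K_kernel ::
    "real set \<Rightarrow> (real \<Rightarrow> real \<Rightarrow> real \<Rightarrow> real) \<Rightarrow> real \<Rightarrow> real \<Rightarrow> real \<Rightarrow> real" where
  "K_kernel \<Lambda> w l \<theta> t = partial_fst \<Lambda> (\<lambda>l \<theta>. ln (w l \<theta> t)) l \<theta>"

definition L_kernel ::
    "real set \<Rightarrow> (real \<Rightarrow> real \<Rightarrow> real \<Rightarrow> real) \<Rightarrow> real \<Rightarrow> real \<Rightarrow> real \<Rightarrow> real" where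
  "L_kernel \<Theta> w l \<theta> t = partial_snd \<Theta> (\<lambda>l \<theta>. ln (w l \<theta> t)) l \<theta>"

text \<open>A function constant on \<open>J\<close> is both nondecreasing and nonincreasing; it gets sign \<open>+1\<close>.\<close>

definition mono_sign :: "real set \<Rightarrow> (real \<Rightarrow> real) \<Rightarrow> real" where
  "mono_sign J f = (if mono_on J f then 1 else if antimono_on J f then -1 else 0)"

end

theory Submission
  imports Defs
begin

text \<open>
  Independence of \<open>K\<close> from \<open>\<theta>\<close> makes every difference \<open>ln (w l \<theta>\<^sub>1 t) - ln (w l \<theta>\<^sub>2 t)\<close> constant
  in \<open>l\<close>, because its \<open>l\<close>-derivative vanishes on an interval.  Hence \<open>L\<close> is independent of \<open>l\<close>, and
  the mixed derivative \<open>\<partial>\<^sub>l \<partial>\<^sub>\<theta> w = \<partial>\<^sub>l (L w)\<close> is just \<open>K L w\<close>, with no term \<open>(\<partial>\<^sub>l L) w\<close>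
  (lemma \<open>weight_derivatives\<close>).

  The domination hypotheses then allow differentiation under the integral twice, first in \<open>l\<close> and then
  in \<open>\<theta>\<close> (lemma \<open>derivative_under_integral\<close>):
  \<open>\<partial>\<^sub>l ln \<Phi> = (\<integral>K w) / \<Phi>\<close> and, by the quotient rule,
  \<open>\<partial>\<^sub>\<theta> \<partial>\<^sub>l ln \<Phi> = ((\<integral>w) (\<integral>K L w) - (\<integral>K w) (\<integral>L w)) / \<Phi>\<^sup>2\<close>.
  This is the covariance of \<open>K\<close> and \<open>L\<close> under the probability density \<open>w / \<Phi>\<close>, so it has the sign
  \<open>\<epsilon>\<^sub>K \<epsilon>\<^sub>L\<close> by Chebyshev's integral inequality (lemma \<open>Chebyshev_integral_signed\<close>).
\<close>

section \<open>Derivatives relative to an interval\<close>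

lemma nondegenerate_interval_convex: "nondegenerate_interval S \<Longrightarrow> convex S"
  by (simp add: nondegenerate_interval_def is_interval_convex)

lemma nondegenerate_interval_islimpt:
  assumes "nondegenerate_interval S" "x \<in> S"
  shows "x islimpt S"
proof -
  obtain a b where "a \<in> S" "b \<in> S" "a < b"
    using assms by (auto simp: nondegenerate_interval_def)
  then have "S \<noteq> {x}" by auto
  then show ?thesis
    using assms connected_imp_perfect nondegenerate_interval_convex convex_connected by blast
qed

lemma nondegenerate_interval_vector_derivative:
  assumes "nondegenerate_interval S" "x \<in> S" "(f has_real_derivative d) (at x within S)"
  shows "vector_derivative f (at x within S) = d"
  using assms nondegenerate_interval_islimpt
  by (metis has_real_derivative_iff_has_vector_derivative trivial_limit_within vector_derivative_within)

lemma has_real_derivative_eq_on: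
  assumes "(f has_real_derivative d) (at x within S)" "x \<in> S" "\<And>y. y \<in> S \<Longrightarrow> g y = f y"
  shows "(g has_real_derivative d) (at x within S)"
  using assms has_vector_derivative_transform
  unfolding has_real_derivative_iff_has_vector_derivative by blast

lemma differentiable_on_imp_has_real_derivative:
  fixes f :: "real \<Rightarrow> real"
  assumes "f differentiable_on S" "x \<in> S"
  shows "(f has_real_derivative vector_derivative f (at x within S)) (at x within S)"
  using assms
  by (simp add: differentiable_on_def has_real_derivative_iff_has_vector_derivative
      flip: vector_derivative_works)

text \<open>
  Majorants are given on compact subintervals only, so a limit at \<open>x\<close> has to be localised to one of
  them.  If \<open>x\<close> is an endpoint of \<open>S\<close>, it is also an endpoint of the subinterval, which is then a
  one-sided neighbourhood.
\<close>
lemma interval_compact_neighbourhood: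
  fixes S :: "real set"
  assumes "is_interval S" "x \<in> S"
  obtains a b where "x \<in> {a..b}" "{a..b} \<subseteq> S" "\<forall>\<^sub>F y in at x within S. y \<in> {a..b}"
proof -
  obtain a where a: "a \<in> S" "a \<le> x" "\<forall>\<^sub>F y in at x within S. a \<le> y"
  proof (cases "\<exists>a\<in>S. a < x")
    case True
    then obtain a where "a \<in> S" "a < x" by blast
    moreover from \<open>a < x\<close> have "\<forall>\<^sub>F y in at x within S. a < y"
      by (rule order_tendstoD(1)[OF tendsto_ident_at])
    then have "\<forall>\<^sub>F y in at x within S. a \<le> y"
      by (rule eventually_mono) simp
    ultimately show ?thesis using that by auto
  next
    case False
    then have "\<forall>\<^sub>F y in at x within S. x \<le> y"
      by (auto simp: eventually_at_filter intro!: always_eventually)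
    then show ?thesis using that \<open>x \<in> S\<close> by auto
  qed
  obtain b where b: "b \<in> S" "x \<le> b" "\<forall>\<^sub>F y in at x within S. y \<le> b"
  proof (cases "\<exists>b\<in>S. x < b")
    case True
    then obtain b where "b \<in> S" "x < b" by blast
    moreover from \<open>x < b\<close> have "\<forall>\<^sub>F y in at x within S. y < b"
      by (rule order_tendstoD(2)[OF tendsto_ident_at])
    then have "\<forall>\<^sub>F y in at x within S. y \<le> b"
      by (rule eventually_mono) simp
    ultimately show ?thesis using that by auto
  next
    case False
    then have "\<forall>\<^sub>F y in at x within S. y \<le> x"
      by (auto simp: eventually_at_filter intro!: always_eventually)
    then show ?thesis using that \<open>x \<in> S\<close> by auto
  qed
  have "{a..b} \<subseteq> S"
    using mem_is_interval_1_I[OF \<open>is_interval S\<close> a(1) b(1)] by auto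
  moreover have "\<forall>\<^sub>F y in at x within S. y \<in> {a..b}"
    using eventually_conj[OF a(3) b(3)] by simp
  ultimately show ?thesis using that[of a b] a b by simp
qed

section \<open>Differentiation under the integral sign\<close>

text \<open>
  By the mean value inequality the majorant of the derivative on a compact neighbourhood of \<open>x\<close> also
  bounds the difference quotients at \<open>x\<close>, so dominated convergence applies along every sequence that
  tends to \<open>x\<close>.  The derivative is measurable because it is a limit of difference quotients.
\<close>
lemma derivative_under_integral:
  fixes f f' :: "real \<Rightarrow> 'a \<Rightarrow> real"
  assumes S: "nondegenerate_interval S" and x: "x \<in> S"
    and int: "\<And>y. y \<in> S \<Longrightarrow> integrable M (f y)"
    and deriv: "\<And>y t. y \<in> S \<Longrightarrow> t \<in> space M \<Longrightarrow>
      ((\<lambda>y. f y t) has_real_derivative f' y t) (at y within S)"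
    and dom: "\<And>a b. {a..b} \<subseteq> S \<Longrightarrow>
      \<exists>m. integrable M m \<and> (AE t in M. \<forall>y\<in>{a..b}. \<bar>f' y t\<bar> \<le> m t)"
  shows "integrable M (f' x)"
    and "((\<lambda>y. \<integral>t. f y t \<partial>M) has_real_derivative (\<integral>t. f' x t \<partial>M)) (at x within S)"
proof -
  obtain a b where xab: "x \<in> {a..b}" and sub: "{a..b} \<subseteq> S"
    and ev: "\<forall>\<^sub>F y in at x within S. y \<in> {a..b}"
    using interval_compact_neighbourhood S x unfolding nondegenerate_interval_def by metis
  obtain m where m: "integrable M m" "AE t in M. \<forall>y\<in>{a..b}. \<bar>f' y t\<bar> \<le> m t"
    using dom[OF sub] by blast
  define q where "q y t = (f y t - f x t) / (y - x)" for y t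
  have q_lim: "((\<lambda>y. q y t) \<longlongrightarrow> f' x t) (at x within S)" if "t \<in> space M" for t
    using deriv[OF x that] by (simp add: has_field_derivative_iff q_def)
  have q_bound: "AE t in M. \<forall>y\<in>{a..b}. y \<noteq> x \<longrightarrow> \<bar>q y t\<bar> \<le> m t"
    using m(2) AE_space
  proof eventually_elim
    case (elim t)
    have "\<bar>q y t\<bar> \<le> m t" if "y \<in> {a..b}" "y \<noteq> x" for y
    proof -
      have "norm (f y t - f x t) \<le> m t * norm (y - x)"
      proof (rule field_differentiable_bound[where S = "{a..b}"])
        show "((\<lambda>y. f y t) has_field_derivative f' z t) (at z within {a..b})" if "z \<in> {a..b}" for z
          using deriv[of z t] that sub elim has_field_derivative_subset by blast
      qed (use elim that xab in auto)
      then show ?thesis using that by (simp add: q_def field_simps)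
    qed
    then show ?case by blast
  qed
  have q_int: "integrable M (q y)" if "y \<in> S" for y
    unfolding q_def using int that x by auto
  have seq: "integrable M (f' x) \<and> (\<lambda>i. \<integral>t. q (X i) t \<partial>M) \<longlonglongrightarrow> (\<integral>t. f' x t \<partial>M)"
    if X: "\<And>i. X i \<in> S - {x}" "X \<longlonglongrightarrow> x" for X
  proof -
    have X_at: "filterlim X (at x within S) sequentially"
      using X by (auto simp: filterlim_at)
    obtain N where N: "\<And>i. i \<ge> N \<Longrightarrow> X i \<in> {a..b}"
      using filterlim_iff[THEN iffD1, OF X_at, rule_format, OF ev]
      by (auto simp: eventually_sequentially)
    define Y where "Y i = X (i + N)" for i
    have Y: "Y i \<in> {a..b}" "Y i \<noteq> x" "Y i \<in> S" for i
      using N X by (auto simp: Y_def)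
    have Y_at: "filterlim Y (at x within S) sequentially"
      unfolding Y_def by (rule filterlim_compose[OF X_at filterlim_add_const_nat_at_top])
    have lim: "(\<lambda>i. q (Y i) t) \<longlonglongrightarrow> f' x t" if "t \<in> space M" for t
      by (rule filterlim_compose[OF q_lim[OF that] Y_at])
    have meas: "f' x \<in> borel_measurable M"
      by (rule borel_measurable_LIMSEQ_metric[where f = "\<lambda>i. q (Y i)"])
        (use q_int Y lim in auto)
    have lim_AE: "AE t in M. (\<lambda>i. q (Y i) t) \<longlonglongrightarrow> f' x t"
      using lim by auto
    have bound: "AE t in M. norm (q (Y i) t) \<le> m t" for i
      using q_bound by eventually_elim (use Y in auto)
    have q_meas: "q (Y i) \<in> borel_measurable M" for i
      using q_int Y by auto
    note dc = meas q_meas m(1) lim_AE bound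
    have "(\<lambda>i. \<integral>t. q (X (i + N)) t \<partial>M) \<longlonglongrightarrow> (\<integral>t. f' x t \<partial>M)"
      using integral_dominated_convergence[OF dc] by (simp add: Y_def)
    then show ?thesis
      using integrable_dominated_convergence[OF dc]
        LIMSEQ_offset[where f = "\<lambda>i. \<integral>t. q (X i) t \<partial>M"] by simp
  qed
  show "integrable M (f' x)"
    using nondegenerate_interval_islimpt[OF S x] seq unfolding islimpt_sequential by blast
  have "((\<lambda>y. \<integral>t. q y t \<partial>M) \<longlongrightarrow> (\<integral>t. f' x t \<partial>M)) (at x within S)"
    unfolding tendsto_at_iff_sequentially comp_def using seq by blast
  moreover have "(\<integral>t. q y t \<partial>M) = ((\<integral>t. f y t \<partial>M) - (\<integral>t. f x t \<partial>M)) / (y - x)" if "y \<in> S" for y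
    unfolding q_def using int that x by simp
  ultimately show "((\<lambda>y. \<integral>t. f y t \<partial>M) has_real_derivative (\<integral>t. f' x t \<partial>M)) (at x within S)"
    unfolding has_field_derivative_iff
    by (elim Lim_transform_eventually) (auto simp: eventually_at_filter)
qed

section \<open>Chebyshev's integral inequality\<close>

text \<open>
  The product \<open>(f s - f t) (g s - g t) w s w t\<close> is integrated first over \<open>t\<close> and then over \<open>s\<close>.  Each
  integration expands into products of single integrals, which avoids the product
  measure and lets the inequality hold over an arbitrary measure.
\<close>
lemma Chebyshev_integral_signed:
  fixes f g w :: "'a \<Rightarrow> real"
  assumes sign: "\<And>s t. s \<in> space M \<Longrightarrow> t \<in> space M \<Longrightarrow> 0 \<le> c * ((f s - f t) * (g s - g t))"
    and w: "\<And>t. t \<in> space M \<Longrightarrow> 0 \<le> w t"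
    and int: "integrable M w" "integrable M (\<lambda>t. f t * w t)" "integrable M (\<lambda>t. g t * w t)"
      "integrable M (\<lambda>t. f t * g t * w t)"
  shows "0 \<le> c * ((\<integral>t. w t \<partial>M) * (\<integral>t. f t * g t * w t \<partial>M)
                  - (\<integral>t. f t * w t \<partial>M) * (\<integral>t. g t * w t \<partial>M))"
proof -
  define W F G H where "W = (\<integral>t. w t \<partial>M)" and "F = (\<integral>t. f t * w t \<partial>M)"
    and "G = (\<integral>t. g t * w t \<partial>M)" and "H = (\<integral>t. f t * g t * w t \<partial>M)"
  note int [simp]
  have inner: "0 \<le> c * (f s * g s * W - f s * G - g s * F + H)" if s: "s \<in> space M" for s
  proof -
    have "0 \<le> (\<integral>t. c * ((f s - f t) * (g s - g t)) * w t \<partial>M)"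
      by (rule Bochner_Integration.integral_nonneg) (use s sign w in auto)
    also have "\<dots> = (\<integral>t. c * (f s * g s * w t - f s * (g t * w t) - g s * (f t * w t)
                            + f t * g t * w t) \<partial>M)"
      by (rule Bochner_Integration.integral_cong) (auto simp: algebra_simps)
    also have "\<dots> = c * (f s * g s * W - f s * G - g s * F + H)"
      by (simp add: W_def F_def G_def H_def)
    finally show ?thesis .
  qed
  have "0 \<le> (\<integral>s. c * (f s * g s * W - f s * G - g s * F + H) * w s \<partial>M)"
    by (rule Bochner_Integration.integral_nonneg) (use inner w in auto)
  also have "\<dots> = (\<integral>s. c * (W * (f s * g s * w s) - G * (f s * w s) - F * (g s * w s)
                          + H * w s) \<partial>M)"
    by (rule Bochner_Integration.integral_cong) (auto simp: algebra_simps)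
  also have "\<dots> = c * (W * H - G * F - F * G + H * W)"
    by (simp add: W_def F_def G_def H_def)
  finally have "0 \<le> 2 * (c * (W * H - F * G))"
    by (simp add: algebra_simps)
  then show ?thesis
    by (simp add: W_def F_def G_def H_def)
qed

lemma mono_sign_increment:
  assumes "mono_on J f \<or> antimono_on J f" "s \<in> J" "t \<in> J" "s \<le> t"
  shows "0 \<le> mono_sign J f * (f t - f s)"
  using assms by (auto simp: mono_sign_def monotone_on_def)

lemma mono_sign_comonotone:
  assumes f: "mono_on J f \<or> antimono_on J f" and g: "mono_on J g \<or> antimono_on J g"
    and "s \<in> J" "t \<in> J"
  shows "0 \<le> mono_sign J f * mono_sign J g * ((f s - f t) * (g s - g t))"
proof -
  have "0 \<le> mono_sign J f * mono_sign J g * ((f s - f t) * (g s - g t))"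
    if "s \<in> J" "t \<in> J" "t \<le> s" for s t
    using mult_nonneg_nonneg[OF mono_sign_increment[OF f that(2,1,3)]
        mono_sign_increment[OF g that(2,1,3)]]
    by (simp add: mult_ac)
  from this[of s t] this[of t s] show ?thesis
    using assms(3,4) by (cases "t \<le> s") (auto simp: algebra_simps)
qed

section \<open>Weights whose first kernel does not depend on the second parameter\<close>

lemma has_real_derivative_from_ln:
  fixes f :: "real \<Rightarrow> real"
  assumes "\<And>y. y \<in> S \<Longrightarrow> 0 < f y" "x \<in> S"
    and "((\<lambda>y. ln (f y)) has_real_derivative d) (at x within S)"
  shows "(f has_real_derivative d * f x) (at x within S)"
proof -
  have "((\<lambda>y. exp (ln (f y))) has_real_derivative exp (ln (f x)) * d) (at x within S)"
    by (rule DERIV_chain2[OF DERIV_exp assms(3)])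
  then have "((\<lambda>y. exp (ln (f y))) has_real_derivative d * f x) (at x within S)"
    using assms by (simp add: mult.commute)
  then show ?thesis
    by (rule has_real_derivative_eq_on) (use assms in auto)
qed

text \<open>
  The mixed derivative comes from differentiating \<open>\<partial>\<^sub>\<theta> w = L w\<close> in \<open>l\<close>, where \<open>L\<close> counts as a
  constant: up to an additive constant in \<open>\<theta>\<close>, the functions \<open>\<theta> \<mapsto> ln (w l \<theta> t)\<close> for
  different \<open>l\<close> coincide.  This identifies the dominated function of
  the second-order hypothesis with the integrand \<open>K L w\<close>.
\<close>
lemma weight_derivatives:
  fixes w :: "real \<Rightarrow> real \<Rightarrow> real \<Rightarrow> real"
  assumes A: "nondegenerate_interval \<Lambda>" and B: "nondegenerate_interval \<Theta>"
    and pos: "\<And>l \<theta>. l \<in> \<Lambda> \<Longrightarrow> \<theta> \<in> \<Theta> \<Longrightarrow> 0 < w l \<theta> t"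
    and diff_fst: "\<And>\<theta>. \<theta> \<in> \<Theta> \<Longrightarrow> (\<lambda>l. ln (w l \<theta> t)) differentiable_on \<Lambda>"
    and diff_snd: "\<And>l. l \<in> \<Lambda> \<Longrightarrow> (\<lambda>\<theta>. ln (w l \<theta> t)) differentiable_on \<Theta>"
    and indep: "\<And>l \<theta> \<theta>'. l \<in> \<Lambda> \<Longrightarrow> \<theta> \<in> \<Theta> \<Longrightarrow> \<theta>' \<in> \<Theta> \<Longrightarrow>
      K_kernel \<Lambda> w l \<theta> t = K_kernel \<Lambda> w l \<theta>' t"
    and l: "l \<in> \<Lambda>" and \<theta>: "\<theta> \<in> \<Theta>"
  shows "((\<lambda>l. w l \<theta> t) has_real_derivative K_kernel \<Lambda> w l \<theta> t * w l \<theta> t) (at l within \<Lambda>)"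
    and "((\<lambda>\<theta>. w l \<theta> t) has_real_derivative L_kernel \<Theta> w l \<theta> t * w l \<theta> t) (at \<theta> within \<Theta>)"
    and "partial_fst \<Lambda> (\<lambda>l \<theta>. w l \<theta> t) l \<theta> = K_kernel \<Lambda> w l \<theta> t * w l \<theta> t"
    and "partial_snd \<Theta> (\<lambda>l \<theta>. w l \<theta> t) l \<theta> = L_kernel \<Theta> w l \<theta> t * w l \<theta> t"
    and "partial_fst \<Lambda> (partial_snd \<Theta> (\<lambda>l \<theta>. w l \<theta> t)) l \<theta>
           = K_kernel \<Lambda> w l \<theta> t * L_kernel \<Theta> w l \<theta> t * w l \<theta> t"
proof -
  have ln_fst: "((\<lambda>l. ln (w l \<eta> t)) has_real_derivative K_kernel \<Lambda> w k \<eta> t) (at k within \<Lambda>)"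
    if "k \<in> \<Lambda>" "\<eta> \<in> \<Theta>" for k \<eta>
    using differentiable_on_imp_has_real_derivative[OF diff_fst] that
    by (simp add: K_kernel_def partial_fst_def)
  have ln_snd: "((\<lambda>\<eta>. ln (w k \<eta> t)) has_real_derivative L_kernel \<Theta> w k \<eta> t) (at \<eta> within \<Theta>)"
    if "k \<in> \<Lambda>" "\<eta> \<in> \<Theta>" for k \<eta>
    using differentiable_on_imp_has_real_derivative[OF diff_snd] that
    by (simp add: L_kernel_def partial_snd_def)
  have w_snd: "((\<lambda>\<eta>. w k \<eta> t) has_real_derivative L_kernel \<Theta> w k \<theta> t * w k \<theta> t) (at \<theta> within \<Theta>)"
    if "k \<in> \<Lambda>" for k
    by (rule has_real_derivative_from_ln) (use that \<theta> pos ln_snd in auto)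
  show w_fst: "((\<lambda>l. w l \<theta> t) has_real_derivative K_kernel \<Lambda> w l \<theta> t * w l \<theta> t) (at l within \<Lambda>)"
    by (rule has_real_derivative_from_ln[where f = "\<lambda>l. w l \<theta> t"]) (use l \<theta> pos ln_fst in auto)
  show "((\<lambda>\<theta>. w l \<theta> t) has_real_derivative L_kernel \<Theta> w l \<theta> t * w l \<theta> t) (at \<theta> within \<Theta>)"
    by (rule w_snd[OF l])
  show "partial_fst \<Lambda> (\<lambda>l \<theta>. w l \<theta> t) l \<theta> = K_kernel \<Lambda> w l \<theta> t * w l \<theta> t"
    unfolding partial_fst_def by (rule nondegenerate_interval_vector_derivative[OF A l w_fst])
  have p_snd: "partial_snd \<Theta> (\<lambda>l \<theta>. w l \<theta> t) k \<theta> = L_kernel \<Theta> w k \<theta> t * w k \<theta> t" if "k \<in> \<Lambda>" for k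
    unfolding partial_snd_def
    by (rule nondegenerate_interval_vector_derivative[OF B \<theta> w_snd[OF that]])
  then show "partial_snd \<Theta> (\<lambda>l \<theta>. w l \<theta> t) l \<theta> = L_kernel \<Theta> w l \<theta> t * w l \<theta> t"
    using l .
  have ln_diff: "ln (w k \<eta> t) = ln (w l \<eta> t) + (ln (w k \<theta> t) - ln (w l \<theta> t))"
    if k: "k \<in> \<Lambda>" and \<eta>: "\<eta> \<in> \<Theta>" for k \<eta>
  proof -
    have "((\<lambda>l. ln (w l \<eta> t) - ln (w l \<theta> t)) has_real_derivative 0) (at x within \<Lambda>)"
      if "x \<in> \<Lambda>" for x
      using DERIV_diff[OF ln_fst[OF that \<eta>] ln_fst[OF that \<theta>]] indep[OF that \<eta> \<theta>] by simp
    then obtain c where "\<forall>x\<in>\<Lambda>. ln (w x \<eta> t) - ln (w x \<theta> t) = c"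
      using has_field_derivative_zero_constant[OF nondegenerate_interval_convex[OF A],
          of "\<lambda>l. ln (w l \<eta> t) - ln (w l \<theta> t)"] by blast
    from bspec[OF this k] bspec[OF this l] show ?thesis by simp
  qed
  have L_indep: "L_kernel \<Theta> w k \<theta> t = L_kernel \<Theta> w l \<theta> t" if k: "k \<in> \<Lambda>" for k
  proof -
    have "((\<lambda>\<eta>. ln (w l \<eta> t) + (ln (w k \<theta> t) - ln (w l \<theta> t)))
             has_real_derivative L_kernel \<Theta> w l \<theta> t) (at \<theta> within \<Theta>)"
      using DERIV_add[OF ln_snd[OF l \<theta>] DERIV_const] by simp
    then have "((\<lambda>\<eta>. ln (w k \<eta> t)) has_real_derivative L_kernel \<Theta> w l \<theta> t) (at \<theta> within \<Theta>)"
      by (rule has_real_derivative_eq_on) (fact \<theta>, erule ln_diff[OF k])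
    then show ?thesis
      unfolding L_kernel_def[of _ _ k] partial_snd_def
      by (rule nondegenerate_interval_vector_derivative[OF B \<theta>])
  qed
  have p_snd_l: "partial_snd \<Theta> (\<lambda>l \<theta>. w l \<theta> t) k \<theta> = L_kernel \<Theta> w l \<theta> t * w k \<theta> t"
    if "k \<in> \<Lambda>" for k
    unfolding p_snd[OF that] L_indep[OF that] ..
  have "((\<lambda>k. partial_snd \<Theta> (\<lambda>l \<theta>. w l \<theta> t) k \<theta>)
           has_real_derivative L_kernel \<Theta> w l \<theta> t * (K_kernel \<Lambda> w l \<theta> t * w l \<theta> t)) (at l within \<Lambda>)"
    by (rule has_real_derivative_eq_on[OF DERIV_cmult[OF w_fst] l]) (erule p_snd_l)
  then have "((\<lambda>k. partial_snd \<Theta> (\<lambda>l \<theta>. w l \<theta> t) k \<theta>)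
           has_real_derivative K_kernel \<Lambda> w l \<theta> t * L_kernel \<Theta> w l \<theta> t * w l \<theta> t) (at l within \<Lambda>)"
    by (simp add: mult_ac)
  then show "partial_fst \<Lambda> (partial_snd \<Theta> (\<lambda>l \<theta>. w l \<theta> t)) l \<theta>
           = K_kernel \<Lambda> w l \<theta> t * L_kernel \<Theta> w l \<theta> t * w l \<theta> t"
    unfolding partial_fst_def by (rule nondegenerate_interval_vector_derivative[OF A l])
qed

section \<open>The sign of the mixed logarithmic derivative\<close>

theorem theorem2p17:
  fixes \<Lambda> \<Theta> J :: "real set" and \<mu> :: "real measure"
    and w :: "real \<Rightarrow> real \<Rightarrow> real \<Rightarrow> real" and l \<theta> :: real
  assumes "nondegenerate_interval \<Lambda>" and "nondegenerate_interval \<Theta>"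
    and "index_measure J \<mu>"
    and "weight_family \<Lambda> \<Theta> J \<mu> w"
    and "regular_first_order \<Lambda> \<Theta> J \<mu> w"
    and "regular_second_order \<Lambda> \<Theta> J \<mu> w"
    and "\<forall>l\<in>\<Lambda>. \<forall>\<theta>\<in>\<Theta>. \<forall>\<theta>'\<in>\<Theta>. \<forall>t\<in>J. K_kernel \<Lambda> w l \<theta> t = K_kernel \<Lambda> w l \<theta>' t"
    and "l \<in> \<Lambda>" and "\<theta> \<in> \<Theta>"
    and "mono_on J (K_kernel \<Lambda> w l \<theta>) \<or> antimono_on J (K_kernel \<Lambda> w l \<theta>)"
    and "mono_on J (L_kernel \<Theta> w l \<theta>) \<or> antimono_on J (L_kernel \<Theta> w l \<theta>)"
  shows "(\<forall>\<theta>'\<in>\<Theta>. (\<lambda>l'. ln (\<Phi> \<mu> w l' \<theta>')) differentiable (at l within \<Lambda>)) \<and>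
    (\<lambda>\<theta>'. partial_fst \<Lambda> (\<lambda>l \<theta>. ln (\<Phi> \<mu> w l \<theta>)) l \<theta>') differentiable (at \<theta> within \<Theta>) \<and>
    mono_sign J (K_kernel \<Lambda> w l \<theta>) * mono_sign J (L_kernel \<Theta> w l \<theta>) *
      partial_snd \<Theta> (partial_fst \<Lambda> (\<lambda>l \<theta>. ln (\<Phi> \<mu> w l \<theta>))) l \<theta> \<ge> 0"
proof -
  define K where "K t = K_kernel \<Lambda> w l \<theta> t" for t
  define L where "L \<eta> t = L_kernel \<Theta> w l \<eta> t" for \<eta> t
  have space: "space \<mu> = J"
    using assms(3) by (auto simp: index_measure_def space_restrict_space)
  have pos: "0 < w k \<eta> t" if "k \<in> \<Lambda>" "\<eta> \<in> \<Theta>" "t \<in> J" for k \<eta> t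
    using assms(4) that by (auto simp: weight_family_def)
  have int: "integrable \<mu> (w k \<eta>)" and \<Phi>_pos: "0 < \<Phi> \<mu> w k \<eta>" if "k \<in> \<Lambda>" "\<eta> \<in> \<Theta>" for k \<eta>
    using assms(4) that by (auto simp: weight_family_def)
  have diff_fst: "(\<lambda>l. ln (w l \<eta> t)) differentiable_on \<Lambda>" if "\<eta> \<in> \<Theta>" "t \<in> J" for \<eta> t
    using assms(5) that by (auto simp: regular_first_order_def C1_on_def)
  have diff_snd: "(\<lambda>\<theta>. ln (w k \<theta> t)) differentiable_on \<Theta>" if "k \<in> \<Lambda>" "t \<in> J" for k t
    using assms(5) that by (auto simp: regular_first_order_def C1_on_def)
  have K_eq: "K_kernel \<Lambda> w l \<eta> t = K t" if "\<eta> \<in> \<Theta>" "t \<in> J" for \<eta> t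
    using assms(7,8,9) that unfolding K_def by blast
  have wd: "((\<lambda>l. w l \<eta> t) has_real_derivative K_kernel \<Lambda> w k \<eta> t * w k \<eta> t) (at k within \<Lambda>)"
    "((\<lambda>\<theta>. w k \<theta> t) has_real_derivative L_kernel \<Theta> w k \<eta> t * w k \<eta> t) (at \<eta> within \<Theta>)"
    "partial_fst \<Lambda> (\<lambda>l \<theta>. w l \<theta> t) k \<eta> = K_kernel \<Lambda> w k \<eta> t * w k \<eta> t"
    "partial_snd \<Theta> (\<lambda>l \<theta>. w l \<theta> t) k \<eta> = L_kernel \<Theta> w k \<eta> t * w k \<eta> t"
    "partial_fst \<Lambda> (partial_snd \<Theta> (\<lambda>l \<theta>. w l \<theta> t)) k \<eta>
       = K_kernel \<Lambda> w k \<eta> t * L_kernel \<Theta> w k \<eta> t * w k \<eta> t"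
    if "k \<in> \<Lambda>" "\<eta> \<in> \<Theta>" "t \<in> J" for k \<eta> t
    by (rule weight_derivatives[OF assms(1,2)];
        use that pos diff_fst diff_snd assms(7) in blast)+

  have dom_fst: "\<exists>m. integrable \<mu> m \<and> (AE t in \<mu>. \<forall>k\<in>{a..b}. \<bar>K_kernel \<Lambda> w k \<eta> t * w k \<eta> t\<bar> \<le> m t)"
    if \<eta>: "\<eta> \<in> \<Theta>" and sub: "{a..b} \<subseteq> \<Lambda>" for \<eta> a b
  proof -
    obtain m where m: "integrable \<mu> m"
      "AE t in \<mu>. \<forall>k\<in>{a..b}. \<bar>partial_fst \<Lambda> (\<lambda>l \<theta>. w l \<theta> t) k \<eta>\<bar> \<le> m t"
      using assms(5)[unfolded regular_first_order_def, THEN conjunct1, THEN bspec, OF \<eta>,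
          THEN conjunct2, THEN spec, THEN spec, THEN mp, OF sub] by blast
    have "AE t in \<mu>. \<forall>k\<in>{a..b}. \<bar>K_kernel \<Lambda> w k \<eta> t * w k \<eta> t\<bar> \<le> m t"
      using m(2) AE_space by eventually_elim (use \<eta> sub space wd(3) in \<open>auto simp: subset_iff\<close>)
    with m(1) show ?thesis by blast
  qed
  have dom_snd: "\<exists>m. integrable \<mu> m \<and> (AE t in \<mu>. \<forall>\<eta>\<in>{c..d}. \<bar>L \<eta> t * w l \<eta> t\<bar> \<le> m t)"
    if sub: "{c..d} \<subseteq> \<Theta>" for c d
  proof -
    obtain m where m: "integrable \<mu> m"
      "AE t in \<mu>. \<forall>\<eta>\<in>{c..d}. \<bar>partial_snd \<Theta> (\<lambda>l \<theta>. w l \<theta> t) l \<eta>\<bar> \<le> m t"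
      using assms(5)[unfolded regular_first_order_def, THEN conjunct2, THEN bspec, OF assms(8),
          THEN conjunct2, THEN spec, THEN spec, THEN mp, OF sub] by blast
    have "AE t in \<mu>. \<forall>\<eta>\<in>{c..d}. \<bar>L \<eta> t * w l \<eta> t\<bar> \<le> m t"
      using m(2) AE_space
      by eventually_elim (use sub space wd(4) assms(8) in \<open>auto simp: subset_iff L_def\<close>)
    with m(1) show ?thesis by blast
  qed
  have dom_mixed: "\<exists>m. integrable \<mu> m \<and> (AE t in \<mu>. \<forall>\<eta>\<in>{c..d}. \<bar>K t * L \<eta> t * w l \<eta> t\<bar> \<le> m t)"
    if sub: "{c..d} \<subseteq> \<Theta>" for c d
  proof -
    \<comment> \<open>The integral is differentiated in \<open>\<theta>\<close> alone, at the fixed \<open>l\<close>, so the rectangle can be a segment.\<close>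
    have "{l..l} \<subseteq> \<Lambda>" using \<open>l \<in> \<Lambda>\<close> by simp
    then obtain m where m: "integrable \<mu> m" "AE t in \<mu>. \<forall>k\<in>{l..l}. \<forall>\<eta>\<in>{c..d}.
        \<bar>partial_fst \<Lambda> (partial_snd \<Theta> (\<lambda>l \<theta>. w l \<theta> t)) k \<eta>\<bar> \<le> m t"
      using assms(6)[unfolded regular_second_order_def, THEN conjunct2, THEN spec, THEN spec,
          THEN spec, THEN spec, THEN mp, OF conjI[OF _ sub]] by blast
    have "AE t in \<mu>. \<forall>\<eta>\<in>{c..d}. \<bar>K t * L \<eta> t * w l \<eta> t\<bar> \<le> m t"
      using m(2) AE_space
      by eventually_elim (use sub space wd(5) assms(8) K_eq in \<open>auto simp: subset_iff L_def\<close>)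
    with m(1) show ?thesis by blast
  qed

  define A where "A \<eta> = (\<integral>t. K t * w l \<eta> t \<partial>\<mu>)" for \<eta>
  have int_Kw: "integrable \<mu> (\<lambda>t. K t * w l \<eta> t)"
    and ln_\<Phi>_fst: "((\<lambda>k. ln (\<Phi> \<mu> w k \<eta>)) has_real_derivative A \<eta> / \<Phi> \<mu> w l \<eta>) (at l within \<Lambda>)"
    if \<eta>: "\<eta> \<in> \<Theta>" for \<eta>
  proof -
    note diff = derivative_under_integral[where f = "\<lambda>k. w k \<eta>" and M = \<mu>
        and f' = "\<lambda>k t. K_kernel \<Lambda> w k \<eta> t * w k \<eta> t", OF assms(1) assms(8) int[OF _ \<eta>] _
        dom_fst[OF \<eta>], unfolded space, OF _ wd(1)[OF _ \<eta>], simplified]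
    have "integrable \<mu> (\<lambda>t. K_kernel \<Lambda> w l \<eta> t * w l \<eta> t)"
      by (rule diff(1))
    moreover have "integrable \<mu> (\<lambda>t. K_kernel \<Lambda> w l \<eta> t * w l \<eta> t)
        \<longleftrightarrow> integrable \<mu> (\<lambda>t. K t * w l \<eta> t)"
      by (rule Bochner_Integration.integrable_cong) (use K_eq \<eta> space in auto)
    ultimately show "integrable \<mu> (\<lambda>t. K t * w l \<eta> t)" by simp
    have "(\<integral>t. K_kernel \<Lambda> w l \<eta> t * w l \<eta> t \<partial>\<mu>) = A \<eta>"
      unfolding A_def by (rule Bochner_Integration.integral_cong) (use K_eq \<eta> space in auto)
    then have "((\<lambda>k. \<Phi> \<mu> w k \<eta>) has_real_derivative A \<eta>) (at l within \<Lambda>)"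
      using diff(2) by (simp add: \<Phi>_def)
    from DERIV_chain2[OF DERIV_ln_divide[OF \<Phi>_pos[OF assms(8) \<eta>]] this]
    show "((\<lambda>k. ln (\<Phi> \<mu> w k \<eta>)) has_real_derivative A \<eta> / \<Phi> \<mu> w l \<eta>) (at l within \<Lambda>)"
      by simp
  qed

  have w_snd: "((\<lambda>\<eta>. w l \<eta> t) has_real_derivative L \<eta> t * w l \<eta> t) (at \<eta> within \<Theta>)"
    if "\<eta> \<in> \<Theta>" "t \<in> space \<mu>" for \<eta> t
    using wd(2) assms(8) that space by (simp add: L_def)
  have Kw_snd: "((\<lambda>\<eta>. K t * w l \<eta> t) has_real_derivative K t * L \<eta> t * w l \<eta> t) (at \<eta> within \<Theta>)"
    if "\<eta> \<in> \<Theta>" "t \<in> space \<mu>" for \<eta> t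
    using DERIV_cmult[OF w_snd[OF that], of "K t"] by (simp add: mult.assoc)
  note diff_w = derivative_under_integral[OF assms(2,9) int[OF assms(8)] w_snd dom_snd]
  note diff_Kw = derivative_under_integral[OF assms(2,9) int_Kw Kw_snd dom_mixed]
  define D where "D = ((\<integral>t. w l \<theta> t \<partial>\<mu>) * (\<integral>t. K t * L \<theta> t * w l \<theta> t \<partial>\<mu>)
                  - (\<integral>t. K t * w l \<theta> t \<partial>\<mu>) * (\<integral>t. L \<theta> t * w l \<theta> t \<partial>\<mu>))"
  have "((\<lambda>\<eta>. A \<eta> / \<Phi> \<mu> w l \<eta>) has_real_derivative D / (\<Phi> \<mu> w l \<theta>)\<^sup>2) (at \<theta> within \<Theta>)"
    using DERIV_divide[OF diff_Kw(2) diff_w(2)] \<Phi>_pos[OF assms(8,9)]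
    by (simp add: A_def \<Phi>_def D_def power2_eq_square mult_ac)
  moreover have ln_\<Phi>_partial: "partial_fst \<Lambda> (\<lambda>l \<theta>. ln (\<Phi> \<mu> w l \<theta>)) l \<eta> = A \<eta> / \<Phi> \<mu> w l \<eta>"
    if "\<eta> \<in> \<Theta>" for \<eta>
    unfolding partial_fst_def
    by (rule nondegenerate_interval_vector_derivative[OF assms(1,8) ln_\<Phi>_fst[OF that]])
  ultimately have mixed: "((\<lambda>\<eta>. partial_fst \<Lambda> (\<lambda>l \<theta>. ln (\<Phi> \<mu> w l \<theta>)) l \<eta>)
      has_real_derivative D / (\<Phi> \<mu> w l \<theta>)\<^sup>2) (at \<theta> within \<Theta>)"
    using assms(9) by (elim has_real_derivative_eq_on) auto

  have "0 \<le> mono_sign J K * mono_sign J (L \<theta>) * D"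
    unfolding D_def
  proof (rule Chebyshev_integral_signed)
    show "0 \<le> mono_sign J K * mono_sign J (L \<theta>) * ((K s - K t) * (L \<theta> s - L \<theta> t))"
      if "s \<in> space \<mu>" "t \<in> space \<mu>" for s t
      using mono_sign_comonotone[OF assms(10,11)] that space
      unfolding K_def[abs_def] L_def[abs_def] by blast
    show "0 \<le> w l \<theta> t" if "t \<in> space \<mu>" for t
      using pos assms(8,9) that space by (simp add: less_imp_le)
  qed (use int int_Kw diff_w(1) diff_Kw(1) assms(8,9) in blast)+
  moreover have "partial_snd \<Theta> (partial_fst \<Lambda> (\<lambda>l \<theta>. ln (\<Phi> \<mu> w l \<theta>))) l \<theta> = D / (\<Phi> \<mu> w l \<theta>)\<^sup>2"
    unfolding partial_snd_def
    by (rule nondegenerate_interval_vector_derivative[OF assms(2,9) mixed])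
  ultimately have "0 \<le> mono_sign J (K_kernel \<Lambda> w l \<theta>) * mono_sign J (L_kernel \<Theta> w l \<theta>) *
      partial_snd \<Theta> (partial_fst \<Lambda> (\<lambda>l \<theta>. ln (\<Phi> \<mu> w l \<theta>))) l \<theta>"
    by (simp add: K_def[abs_def] L_def[abs_def])
  moreover have "\<forall>\<eta>\<in>\<Theta>. (\<lambda>k. ln (\<Phi> \<mu> w k \<eta>)) differentiable (at l within \<Lambda>)"
    using ln_\<Phi>_fst real_differentiable_def by blast
  moreover have "(\<lambda>\<eta>. partial_fst \<Lambda> (\<lambda>l \<theta>. ln (\<Phi> \<mu> w l \<theta>)) l \<eta>) differentiable (at \<theta> within \<Theta>)"
    using mixed real_differentiable_def by blast
  ultimately show ?thesis by blast
qed

end
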